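(* For every $\lambda=(\lambda_1,\lambda_2,\lambda_3)\in\Bbbk^3$, the algebra $H_\lambda$ is not of finite representation type.
   Context: $\Bbbk$ is an algebraically closed field of characteristic zero, $N,M\ge2$ are integers, $\Gamma=\langle g_1,g_2: g_1g_2=g_2g_1,\ g_1^{2N}=g_2^{2M}=1\rangle$. $H_\lambda$ is the ($32NM$-dimensional) algebra generated by $\Gamma$ and $a_1,a_2$ with relations $g_1a_1=-a_1g_1$, $g_1a_2=-a_2g_1$, $g_2a_1=a_1g_2$, $g_2a_2=-a_2g_2$, $a_1^2=\lambda_1(1-g_1^2)$, $a_2^2=\lambda_2(1-g_2^2)$, $a_1a_2a_1a_2+a_2a_1a_2a_1=\lambda_3(1-g_1^2g_2^2)-2\lambda_1\lambda_2(1+g_2^2)(1-g_1^2)$. An algebra is of finite representation type if it has only finitely many isomorphism classes of finite-dimensional indecomposable modules. *)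

theory Defs
  imports
    "HOL-Algebra.QuotRing"
    "HOL-Algebra.Module"
    "HOL-Algebra.Algebraic_Closure_Type"
    "HOL-Library.Poly_Mapping"
begin

section \<open>Modules over noncommutative algebras\<close>

text \<open>
  The module and algebra locales of HOL-Algebra require commutative rings, so only their
  record type is reused here. In a record for a module the ring components
  \<open>mult\<close> and \<open>one\<close> are meaningless, as in HOL-Algebra.
\<close>

locale assoc_algebra = ring A for A :: "('k::field, 'a) module" (structure) +
  assumes scale_closed: "x \<in> carrier A \<Longrightarrow> c \<odot> x \<in> carrier A"
    and scale_l_distr: "x \<in> carrier A \<Longrightarrow> (c + d) \<odot> x = c \<odot> x \<oplus> d \<odot> x"
    and scale_r_distr: "\<lbrakk>x \<in> carrier A; y \<in> carrier A\<rbrakk> \<Longrightarrow> c \<odot> (x \<oplus> y) = c \<odot> x \<oplus> c \<odot> y"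
    and scale_assoc: "x \<in> carrier A \<Longrightarrow> (c * d) \<odot> x = c \<odot> (d \<odot> x)"
    and scale_one: "x \<in> carrier A \<Longrightarrow> 1 \<odot> x = x"
    and scale_mult_left: "\<lbrakk>x \<in> carrier A; y \<in> carrier A\<rbrakk> \<Longrightarrow> (c \<odot> x) \<otimes> y = c \<odot> (x \<otimes> y)"
    and scale_mult_right: "\<lbrakk>x \<in> carrier A; y \<in> carrier A\<rbrakk> \<Longrightarrow> x \<otimes> (c \<odot> y) = c \<odot> (x \<otimes> y)"

locale left_module = A?: ring A + M?: abelian_group M
  for A :: "('k::field, 'a) module" (structure) and M :: "('a, 'm) module" (structure) +
  assumes act_closed: "\<lbrakk>a \<in> carrier A; x \<in> carrier M\<rbrakk> \<Longrightarrow> a \<odot>\<^bsub>M\<^esub> x \<in> carrier M"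
    and act_l_distr: "\<lbrakk>a \<in> carrier A; b \<in> carrier A; x \<in> carrier M\<rbrakk>
      \<Longrightarrow> (a \<oplus>\<^bsub>A\<^esub> b) \<odot>\<^bsub>M\<^esub> x = a \<odot>\<^bsub>M\<^esub> x \<oplus>\<^bsub>M\<^esub> b \<odot>\<^bsub>M\<^esub> x"
    and act_r_distr: "\<lbrakk>a \<in> carrier A; x \<in> carrier M; y \<in> carrier M\<rbrakk>
      \<Longrightarrow> a \<odot>\<^bsub>M\<^esub> (x \<oplus>\<^bsub>M\<^esub> y) = a \<odot>\<^bsub>M\<^esub> x \<oplus>\<^bsub>M\<^esub> a \<odot>\<^bsub>M\<^esub> y"
    and act_assoc: "\<lbrakk>a \<in> carrier A; b \<in> carrier A; x \<in> carrier M\<rbrakk>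
      \<Longrightarrow> (a \<otimes>\<^bsub>A\<^esub> b) \<odot>\<^bsub>M\<^esub> x = a \<odot>\<^bsub>M\<^esub> (b \<odot>\<^bsub>M\<^esub> x)"
    and act_one: "x \<in> carrier M \<Longrightarrow> \<one>\<^bsub>A\<^esub> \<odot>\<^bsub>M\<^esub> x = x"

text \<open>
  A module over a \<open>k\<close>-algebra \<open>A\<close> is a \<open>k\<close>-vector space through \<open>c \<mapsto> c \<cdot> 1\<^sub>A\<close>.
\<close>

definition fin_dim_module :: "('k::field, 'a) module \<Rightarrow> ('a, 'm) module \<Rightarrow> bool" where
  "fin_dim_module A M \<longleftrightarrow> (\<exists>B. finite B \<and> B \<subseteq> carrier M \<and>
     (\<forall>x\<in>carrier M. \<exists>c :: 'm \<Rightarrow> 'k. x = (\<Oplus>\<^bsub>M\<^esub>b\<in>B. (c b \<odot>\<^bsub>A\<^esub> \<one>\<^bsub>A\<^esub>) \<odot>\<^bsub>M\<^esub> b)))"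

definition indecomposable_module :: "('k::field, 'a) module \<Rightarrow> ('a, 'm) module \<Rightarrow> bool" where
  "indecomposable_module A M \<longleftrightarrow> carrier M \<noteq> {\<zero>\<^bsub>M\<^esub>} \<and>
     (\<forall>U V. submodule U A M \<and> submodule V A M \<and> U \<inter> V = {\<zero>\<^bsub>M\<^esub>} \<and> U <+>\<^bsub>M\<^esub> V = carrier M
        \<longrightarrow> U = {\<zero>\<^bsub>M\<^esub>} \<or> V = {\<zero>\<^bsub>M\<^esub>})"

definition module_iso ::
    "('k::field, 'a) module \<Rightarrow> ('a, 'm) module \<Rightarrow> ('a, 'n) module \<Rightarrow> ('m \<Rightarrow> 'n) set" where
  "module_iso A M N = {h. bij_betw h (carrier M) (carrier N) \<and>
     (\<forall>x\<in>carrier M. \<forall>y\<in>carrier M. h (x \<oplus>\<^bsub>M\<^esub> y) = h x \<oplus>\<^bsub>N\<^esub> h y) \<and>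
     (\<forall>a\<in>carrier A. \<forall>x\<in>carrier M. h (a \<odot>\<^bsub>M\<^esub> x) = a \<odot>\<^bsub>N\<^esub> h x)}"

definition fin_dim_indec_module :: "('k::field, 'a) module \<Rightarrow> ('a, 'm) module \<Rightarrow> bool" where
  "fin_dim_indec_module A M \<longleftrightarrow>
     left_module A M \<and> fin_dim_module A M \<and> indecomposable_module A M"

text \<open>
  HOL cannot collect modules over all element types in one set. The type \<open>nat \<Rightarrow> 'k\<close> is large
  enough: by lemma \<open>fin_dim_indec_module_copy\<close> below, every finite-dimensional indecomposable
  module, whatever its element type, is isomorphic to one whose elements are in that type.
\<close>

definition fin_dim_indec_modules :: "('k::field, 'a) module \<Rightarrow> ('a, nat \<Rightarrow> 'k) module set" where
  "fin_dim_indec_modules A = {M. fin_dim_indec_module A M}"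

definition module_iso_rel ::
    "('k::field, 'a) module \<Rightarrow> (('a, nat \<Rightarrow> 'k) module \<times> ('a, nat \<Rightarrow> 'k) module) set" where
  "module_iso_rel A = {(M, N). M \<in> fin_dim_indec_modules A \<and> N \<in> fin_dim_indec_modules A \<and>
     module_iso A M N \<noteq> {}}"

definition finite_representation_type :: "('k::field, 'a) module \<Rightarrow> bool" where
  "finite_representation_type A \<longleftrightarrow> finite (fin_dim_indec_modules A // module_iso_rel A)"


section \<open>Algebras given by generators and relations\<close>

text \<open>The free monoid, written additively because \<open>Poly_Mapping\<close> convolves over \<open>+\<close>.\<close>

datatype 'g fmon = Word "'g list"

instantiation fmon :: (type) monoid_add
begin

definition zero_fmon :: "'g fmon" where
  "zero_fmon = Word []"

fun plus_fmon :: "'g fmon \<Rightarrow> 'g fmon \<Rightarrow> 'g fmon" where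
  "plus_fmon (Word u) (Word v) = Word (u @ v)"

instance
proof
  fix a b c :: "'g fmon"
  show "a + b + c = a + (b + c)" by (cases a; cases b; cases c) simp
  show "0 + a = a" by (cases a) (simp add: zero_fmon_def)
  show "a + 0 = a" by (cases a) (simp add: zero_fmon_def)
qed

end

type_synonym ('g, 'k) free_alg = "'g fmon \<Rightarrow>\<^sub>0 'k"

definition gen :: "'g \<Rightarrow> ('g, 'k::field) free_alg" where
  "gen x = Poly_Mapping.single (Word [x]) 1"

definition scalar :: "'k::field \<Rightarrow> ('g, 'k) free_alg" where
  "scalar c = Poly_Mapping.single 0 c"

text \<open>\<open>genideal\<close> is the generated two-sided ideal.\<close>

definition presented_ideal :: "(('g, 'k::field) free_alg \<times> ('g, 'k) free_alg) set \<Rightarrow> ('g, 'k) free_alg set"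
  where "presented_ideal S = genideal ring_of_type_algebra {p - q | p q. (p, q) \<in> S}"

definition presented_algebra ::
    "(('g, 'k::field) free_alg \<times> ('g, 'k) free_alg) set \<Rightarrow> ('k, ('g, 'k) free_alg set) module" where
  "presented_algebra S =
     (let F = ring_of_type_algebra; I = presented_ideal S; Q = F Quot I in
      \<lparr>carrier = carrier Q, monoid.mult = monoid.mult Q, one = one Q, ring.zero = ring.zero Q, add = add Q,
       module.smult = (\<lambda>c C. (I +>\<^bsub>F\<^esub> scalar c) \<otimes>\<^bsub>Q\<^esub> C)\<rparr>)"


section \<open>The algebras \<open>H\<^sub>\<lambda>\<close>\<close>

datatype generator = G1 | G2 | A1 | A2

text \<open>
  Relations are pairs (left side, right side). The first three are those of the group \<open>\<Gamma>\<close>;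
  they make \<open>g\<^sub>1\<close> and \<open>g\<^sub>2\<close> invertible, so no generators for inverses are needed.
\<close>

definition H_relations ::
    "nat \<Rightarrow> nat \<Rightarrow> 'k::field \<Rightarrow> 'k \<Rightarrow> 'k \<Rightarrow> ((generator, 'k) free_alg \<times> (generator, 'k) free_alg) set"
  where
  "H_relations N M l1 l2 l3 =
     (let g1 = gen G1; g2 = gen G2; a1 = gen A1; a2 = gen A2 in
      {(g1 * g2, g2 * g1),
       (g1 ^ (2 * N), 1),
       (g2 ^ (2 * M), 1),
       (g1 * a1, - (a1 * g1)),
       (g1 * a2, - (a2 * g1)),
       (g2 * a1, a1 * g2),
       (g2 * a2, - (a2 * g2)),
       (a1 ^ 2, scalar l1 * (1 - g1 ^ 2)),
       (a2 ^ 2, scalar l2 * (1 - g2 ^ 2)),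
       (a1 * a2 * a1 * a2 + a2 * a1 * a2 * a1,
        scalar l3 * (1 - g1 ^ 2 * g2 ^ 2)
          - scalar (2 * l1 * l2) * (1 + g2 ^ 2) * (1 - g1 ^ 2))})"

definition H_alg ::
    "nat \<Rightarrow> nat \<Rightarrow> 'k::field \<Rightarrow> 'k \<Rightarrow> 'k \<Rightarrow> ('k, (generator, 'k) free_alg set) module" where
  "H_alg N M l1 l2 l3 = presented_algebra (H_relations N M l1 l2 l3)"


section \<open>Well-formedness\<close>

lemma ring_of_type: "ring (ring_of_type_algebra :: 'a::ring_1 ring)"
proof -
  have "\<exists>y. y + x = 0 \<and> x + y = 0" for x :: 'a
    using add.right_inverse add.left_inverse by blast
  thus ?thesis
    unfolding ring_of_type_algebra_def
    by unfold_locales (auto simp: algebra_simps Units_def)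
qed

lemma presented_ideal_ideal:
  "ideal (presented_ideal S) (ring_of_type_algebra :: ('g, 'k::field) free_alg ring)"
  unfolding presented_ideal_def
  by (rule ring.genideal_ideal[OF ring_of_type]) (simp add: ring_of_type_algebra_def)

lemma scalar_central: "scalar c * p = p * scalar c"
proof (induction p rule: update_induct)
  case const
  show ?case by simp
next
  case (update f a b)
  have "Poly_Mapping.update a b f = f + Poly_Mapping.single a b"
    using update.hyps
    by (intro poly_mapping_eqI) (auto simp: lookup_update lookup_add lookup_single in_keys_iff when_def)
  moreover have "scalar c * Poly_Mapping.single a b = Poly_Mapping.single a b * scalar c"
    by (simp add: scalar_def mult_single mult.commute)
  ultimately show ?case using update.IH by (simp add: distrib_left distrib_right)
qed

lemma presented_algebra_assoc_algebra:
  "assoc_algebra (presented_algebra S :: ('k::field, ('g, 'k) free_alg set) module)"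
proof -
  define F where "F = (ring_of_type_algebra :: ('g, 'k) free_alg ring)"
  define I where "I = presented_ideal S"
  interpret ideal I F unfolding I_def F_def by (rule presented_ideal_ideal)
  interpret Q: ring "F Quot I" by (rule quotient_is_ring)
  define P where "P = (presented_algebra S :: ('k, ('g, 'k) free_alg set) module)"
  have P: "P = \<lparr>carrier = carrier (F Quot I), monoid.mult = monoid.mult (F Quot I), one = one (F Quot I),
      ring.zero = ring.zero (F Quot I), add = add (F Quot I),
      module.smult = (\<lambda>c C. (I +>\<^bsub>F\<^esub> scalar c) \<otimes>\<^bsub>F Quot I\<^esub> C)\<rparr>"
    unfolding P_def presented_algebra_def Let_def F_def I_def ..
  have F: "carrier F = UNIV" "monoid.mult F = (*)" "add F = (+)" "one F = 1"
    by (simp_all add: F_def ring_of_type_algebra_def)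
  have sc: "I +>\<^bsub>F\<^esub> p \<in> carrier (F Quot I)" for p
    by (auto simp: FactRing_def A_RCOSETS_defs a_r_coset_def r_coset_def F)
  have ex: "\<exists>p. C = I +>\<^bsub>F\<^esub> p" if "C \<in> carrier (F Quot I)" for C
    using that by (auto simp: FactRing_def A_RCOSETS_defs a_r_coset_def r_coset_def F)
  have m: "(I +>\<^bsub>F\<^esub> p) \<otimes>\<^bsub>F Quot I\<^esub> (I +>\<^bsub>F\<^esub> q) = I +>\<^bsub>F\<^esub> (p * q)" for p q
    using rcoset_mult_add[of p q] by (simp add: FactRing_def F)
  have a: "(I +>\<^bsub>F\<^esub> p) \<oplus>\<^bsub>F Quot I\<^esub> (I +>\<^bsub>F\<^esub> q) = I +>\<^bsub>F\<^esub> (p + q)" for p q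
    using a_rcos_sum[of p q] by (simp add: FactRing_def F)
  have one: "\<one>\<^bsub>F Quot I\<^esub> = I +>\<^bsub>F\<^esub> 1" by (simp add: FactRing_def F)
  have s: "scalar (c + d) = (scalar c + scalar d :: ('g, 'k) free_alg)"
      "scalar (c * d) = (scalar c * scalar d :: ('g, 'k) free_alg)"
      "scalar 1 = (1 :: ('g, 'k) free_alg)" for c d
    by (simp_all add: scalar_def single_add mult_single)
  have rP: "ring P"
  proof (rule ringI)
    show "abelian_group P"
    proof (rule abelian_groupI)
      fix C assume "C \<in> carrier P"
      thus "\<exists>D\<in>carrier P. D \<oplus>\<^bsub>P\<^esub> C = \<zero>\<^bsub>P\<^esub>"
        using Q.l_neg[of C] Q.a_inv_closed[of C] by (auto simp: P)
    next
      fix C D assume "C \<in> carrier P" "D \<in> carrier P"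
      thus "C \<oplus>\<^bsub>P\<^esub> D = D \<oplus>\<^bsub>P\<^esub> C" using Q.a_comm[of C D] by (simp add: P)
    qed (simp_all add: P Q.a_assoc)
    show "Group.monoid P"
      by (rule Group.monoidI) (simp_all add: P Q.m_assoc)
  qed (simp_all add: P Q.l_distr Q.r_distr)
  interpret RP: ring P by (rule rP)
  show ?thesis unfolding P_def[symmetric]
  proof (unfold_locales)
    fix C D c assume C: "C \<in> carrier P" and D: "D \<in> carrier P"
    then obtain p q where pq: "C = I +>\<^bsub>F\<^esub> p" "D = I +>\<^bsub>F\<^esub> q"
      using ex[of C] ex[of D] by (auto simp: P)
    show "C \<otimes>\<^bsub>P\<^esub> (c \<odot>\<^bsub>P\<^esub> D) = c \<odot>\<^bsub>P\<^esub> (C \<otimes>\<^bsub>P\<^esub> D)"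
      using scalar_central[of c p] by (simp add: P pq m flip: mult.assoc)
  next
    fix C c assume "C \<in> carrier P"
    thus "c \<odot>\<^bsub>P\<^esub> C \<in> carrier P" by (simp add: P sc)
  next
    fix C c d assume "C \<in> carrier P"
    then obtain p where p: "C = I +>\<^bsub>F\<^esub> p" using ex[of C] by (auto simp: P)
    show "(c + d) \<odot>\<^bsub>P\<^esub> C = c \<odot>\<^bsub>P\<^esub> C \<oplus>\<^bsub>P\<^esub> d \<odot>\<^bsub>P\<^esub> C"
      by (simp add: P p m a s distrib_right)
    show "(c * d) \<odot>\<^bsub>P\<^esub> C = c \<odot>\<^bsub>P\<^esub> (d \<odot>\<^bsub>P\<^esub> C)"
      by (simp add: P p m s mult.assoc)
    show "1 \<odot>\<^bsub>P\<^esub> C = C"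
      by (simp add: P p m s)
  next
    fix C D c assume "C \<in> carrier P" "D \<in> carrier P"
    then obtain p q where pq: "C = I +>\<^bsub>F\<^esub> p" "D = I +>\<^bsub>F\<^esub> q"
      using ex[of C] ex[of D] by (auto simp: P)
    show "c \<odot>\<^bsub>P\<^esub> (C \<oplus>\<^bsub>P\<^esub> D) = c \<odot>\<^bsub>P\<^esub> C \<oplus>\<^bsub>P\<^esub> c \<odot>\<^bsub>P\<^esub> D"
      by (simp add: P pq m a distrib_left)
    show "(c \<odot>\<^bsub>P\<^esub> C) \<otimes>\<^bsub>P\<^esub> D = c \<odot>\<^bsub>P\<^esub> (C \<otimes>\<^bsub>P\<^esub> D)"
      by (simp add: P pq m mult.assoc)
  qed
qed

lemma H_alg_assoc_algebra: "assoc_algebra (H_alg N M l1 l2 l3)"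
  unfolding H_alg_def by (rule presented_algebra_assoc_algebra)

lemma fin_dim_indec_module_iso:
  fixes M :: "('a, 'm) module" and M' :: "('a, 'n) module"
  assumes A: "assoc_algebra A" and L': "left_module A M'"
    and M: "fin_dim_indec_module A M" and h: "h \<in> module_iso A M M'"
  shows "fin_dim_indec_module A M'"
proof -
  interpret AA: assoc_algebra A by (rule A)
  interpret L: left_module A M using M by (simp add: fin_dim_indec_module_def)
  interpret L': left_module A M' by (rule L')
  have bij: "bij_betw h (carrier M) (carrier M')"
    and hadd: "\<And>x y. x \<in> carrier M \<Longrightarrow> y \<in> carrier M \<Longrightarrow> h (x \<oplus>\<^bsub>M\<^esub> y) = h x \<oplus>\<^bsub>M'\<^esub> h y"
    and hact: "\<And>a x. a \<in> carrier A \<Longrightarrow> x \<in> carrier M \<Longrightarrow> h (a \<odot>\<^bsub>M\<^esub> x) = a \<odot>\<^bsub>M'\<^esub> h x"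
    using h by (auto simp: module_iso_def)
  have inj: "inj_on h (carrier M)" and im: "h ` carrier M = carrier M'"
    using bij by (auto simp: bij_betw_def)
  have hc: "h x \<in> carrier M'" if "x \<in> carrier M" for x using im that by auto
  have hz: "h \<zero>\<^bsub>M\<^esub> = \<zero>\<^bsub>M'\<^esub>"
  proof -
    have "h \<zero>\<^bsub>M\<^esub> \<oplus>\<^bsub>M'\<^esub> h \<zero>\<^bsub>M\<^esub> = h \<zero>\<^bsub>M\<^esub>"
      using hadd[of "\<zero>\<^bsub>M\<^esub>" "\<zero>\<^bsub>M\<^esub>"] by simp
    thus ?thesis using hc[of "\<zero>\<^bsub>M\<^esub>"] by (metis L'.M.add.r_cancel_one L.M.zero_closed)
  qed
  have hneg: "h (\<ominus>\<^bsub>M\<^esub> x) = \<ominus>\<^bsub>M'\<^esub> h x" if "x \<in> carrier M" for x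
    using hadd[of "\<ominus>\<^bsub>M\<^esub> x" x] that hz hc
    by (metis L'.M.minus_equality L.M.a_inv_closed L.M.l_neg)
  have sc: "c \<odot>\<^bsub>A\<^esub> \<one>\<^bsub>A\<^esub> \<in> carrier A" for c by (simp add: AA.scale_closed)
  have hsum: "h (\<Oplus>\<^bsub>M\<^esub>b\<in>B. f b) = (\<Oplus>\<^bsub>M'\<^esub>b\<in>B. h (f b))"
    if "finite B" "\<And>b. b \<in> B \<Longrightarrow> f b \<in> carrier M" for B :: "'m set" and f
    using that
  proof (induction B)
    case empty
    show ?case by (simp add: hz)
  next
    case (insert x B)
    have "(\<Oplus>\<^bsub>M\<^esub>b\<in>insert x B. f b) = f x \<oplus>\<^bsub>M\<^esub> (\<Oplus>\<^bsub>M\<^esub>b\<in>B. f b)"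
      using insert by (intro L.M.finsum_insert) auto
    moreover have "(\<Oplus>\<^bsub>M'\<^esub>b\<in>insert x B. h (f b)) = h (f x) \<oplus>\<^bsub>M'\<^esub> (\<Oplus>\<^bsub>M'\<^esub>b\<in>B. h (f b))"
      using insert hc by (intro L'.M.finsum_insert) auto
    moreover have "(\<Oplus>\<^bsub>M\<^esub>b\<in>B. f b) \<in> carrier M"
      using insert by (intro L.M.finsum_closed) auto
    ultimately show ?case using insert by (simp add: hadd)
  qed
  have "fin_dim_module A M'"
  proof -
    obtain B where B: "finite B" "B \<subseteq> carrier M"
      and span: "\<forall>x\<in>carrier M. \<exists>c. x = (\<Oplus>\<^bsub>M\<^esub>b\<in>B. (c b \<odot>\<^bsub>A\<^esub> \<one>\<^bsub>A\<^esub>) \<odot>\<^bsub>M\<^esub> b)"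
      using M by (auto simp: fin_dim_indec_module_def fin_dim_module_def)
    have injB: "inj_on h B" using inj B(2) by (rule inj_on_subset)
    show ?thesis unfolding fin_dim_module_def
    proof (intro exI[of _ "h ` B"] conjI ballI)
      show "finite (h ` B)" "h ` B \<subseteq> carrier M'" using B hc by auto
      fix y assume "y \<in> carrier M'"
      then obtain x where x: "x \<in> carrier M" "y = h x" using im by auto
      then obtain c where c: "x = (\<Oplus>\<^bsub>M\<^esub>b\<in>B. (c b \<odot>\<^bsub>A\<^esub> \<one>\<^bsub>A\<^esub>) \<odot>\<^bsub>M\<^esub> b)" using span by blast
      define d where "d z = c (inv_into B h z)" for z
      have "y = (\<Oplus>\<^bsub>M'\<^esub>b\<in>B. h ((c b \<odot>\<^bsub>A\<^esub> \<one>\<^bsub>A\<^esub>) \<odot>\<^bsub>M\<^esub> b))"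
        unfolding x(2) by (subst c, rule hsum) (use B sc L.act_closed in auto)
      also have "\<dots> = (\<Oplus>\<^bsub>M'\<^esub>b\<in>B. (d (h b) \<odot>\<^bsub>A\<^esub> \<one>\<^bsub>A\<^esub>) \<odot>\<^bsub>M'\<^esub> h b)"
        by (rule L'.M.finsum_cong')
           (use B sc hc L'.act_closed injB in \<open>auto simp: hact d_def subset_iff\<close>)
      also have "\<dots> = (\<Oplus>\<^bsub>M'\<^esub>z\<in>h ` B. (d z \<odot>\<^bsub>A\<^esub> \<one>\<^bsub>A\<^esub>) \<odot>\<^bsub>M'\<^esub> z)"
        by (rule L'.M.finsum_reindex[symmetric])
           (use B sc hc L'.act_closed injB in \<open>auto simp: subset_iff\<close>)
      finally show "\<exists>c. y = (\<Oplus>\<^bsub>M'\<^esub>z\<in>h ` B. (c z \<odot>\<^bsub>A\<^esub> \<one>\<^bsub>A\<^esub>) \<odot>\<^bsub>M'\<^esub> z)" by blast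
    qed
  qed
  moreover have "indecomposable_module A M'"
    unfolding indecomposable_module_def
  proof (intro conjI allI impI)
    have indec: "indecomposable_module A M" using M by (simp add: fin_dim_indec_module_def)
    show "carrier M' \<noteq> {\<zero>\<^bsub>M'\<^esub>}"
    proof
      assume "carrier M' = {\<zero>\<^bsub>M'\<^esub>}"
      hence "x = \<zero>\<^bsub>M\<^esub>" if "x \<in> carrier M" for x
        using hc[OF that] hz inj that by (metis L.M.zero_closed inj_onD singletonD)
      hence "carrier M = {\<zero>\<^bsub>M\<^esub>}" by auto
      thus False using indec by (simp add: indecomposable_module_def)
    qed
    fix U V
    assume UV: "submodule U A M' \<and> submodule V A M' \<and> U \<inter> V = {\<zero>\<^bsub>M'\<^esub>} \<and> U <+>\<^bsub>M'\<^esub> V = carrier M'"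
    define pre where "pre W = {x \<in> carrier M. h x \<in> W}" for W
    have sub: "submodule (pre W) A M" if W: "submodule W A M'" for W
    proof -
      interpret W: submodule W A M' by (rule W)
      have Wadd: "x \<oplus>\<^bsub>M'\<^esub> y \<in> W" if "x \<in> W" "y \<in> W" for x y using W.m_closed that by simp
      have Wneg: "\<ominus>\<^bsub>M'\<^esub> x \<in> W" if "x \<in> W" for x
        using W.m_inv_closed that by (simp add: a_inv_def)
      have Wz: "\<zero>\<^bsub>M'\<^esub> \<in> W" using W.one_closed by simp
      show ?thesis
      proof (intro submodule.intro subgroup.intro submodule_axioms.intro)
        fix x assume x: "x \<in> pre W"
        hence "\<ominus>\<^bsub>M\<^esub> x \<in> pre W" by (auto simp: pre_def hneg Wneg)
        thus "inv\<^bsub>add_monoid M\<^esub> x \<in> pre W" by (simp add: a_inv_def)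
      qed (auto simp: pre_def hadd hact hz Wadd Wz L.act_closed)
    qed
    have W0: "W = {\<zero>\<^bsub>M'\<^esub>}" if W: "submodule W A M'" and p: "pre W = {\<zero>\<^bsub>M\<^esub>}" for W
    proof -
      have "W \<subseteq> carrier M'" using W by (auto simp: submodule_def subgroup_def)
      hence "W = h ` pre W" unfolding pre_def using im by auto
      thus ?thesis using p hz by simp
    qed
    have int: "pre U \<inter> pre V = {\<zero>\<^bsub>M\<^esub>}"
    proof -
      have "x = \<zero>\<^bsub>M\<^esub>" if "x \<in> carrier M" "h x \<in> U" "h x \<in> V" for x
        using that UV hz inj by (metis IntI L.M.zero_closed inj_onD singletonD)
      moreover have "\<zero>\<^bsub>M'\<^esub> \<in> U" "\<zero>\<^bsub>M'\<^esub> \<in> V" using UV by auto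
      ultimately show ?thesis by (auto simp: pre_def hz)
    qed
    have sum: "pre U <+>\<^bsub>M\<^esub> pre V = carrier M"
    proof
      show "pre U <+>\<^bsub>M\<^esub> pre V \<subseteq> carrier M"
        by (auto simp: pre_def set_add_def set_mult_def)
      show "carrier M \<subseteq> pre U <+>\<^bsub>M\<^esub> pre V"
      proof
        fix x assume x: "x \<in> carrier M"
        hence "h x \<in> U <+>\<^bsub>M'\<^esub> V" using UV hc by simp
        then obtain u v where uv: "u \<in> U" "v \<in> V" "h x = u \<oplus>\<^bsub>M'\<^esub> v"
          by (auto simp: set_add_def set_mult_def)
        have "u \<in> carrier M'" "v \<in> carrier M'"
          using UV uv by (auto simp: submodule_def subgroup_def)
        then obtain u' v' where u': "u' \<in> carrier M" "v' \<in> carrier M" "u = h u'" "v = h v'"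
          using im by (metis imageE)
        have "h x = h (u' \<oplus>\<^bsub>M\<^esub> v')" using uv u' by (simp add: hadd)
        hence "x = u' \<oplus>\<^bsub>M\<^esub> v'" using inj x u' by (simp add: inj_on_eq_iff)
        thus "x \<in> pre U <+>\<^bsub>M\<^esub> pre V"
          using u' uv by (auto simp: pre_def set_add_def set_mult_def)
      qed
    qed
    have "pre U = {\<zero>\<^bsub>M\<^esub>} \<or> pre V = {\<zero>\<^bsub>M\<^esub>}"
      using indec sub UV int sum unfolding indecomposable_module_def by blast
    thus "U = {\<zero>\<^bsub>M'\<^esub>} \<or> V = {\<zero>\<^bsub>M'\<^esub>}" using W0 UV by blast
  qed
  ultimately show ?thesis using L' by (simp add: fin_dim_indec_module_def)
qed

lemma fin_dim_indec_module_copy: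
  fixes A :: "('k::field, 'a) module" and M :: "('a, 'm) module"
  assumes A: "assoc_algebra A" and M: "fin_dim_indec_module A M"
  shows "\<exists>M' \<in> fin_dim_indec_modules A. module_iso A M M' \<noteq> {}"
proof -
  interpret L: left_module A M using M by (simp add: fin_dim_indec_module_def)
  interpret AA: assoc_algebra A by (rule A)
  have sc: "c \<odot>\<^bsub>A\<^esub> \<one>\<^bsub>A\<^esub> \<in> carrier A" for c by (simp add: AA.scale_closed)
  obtain B where B: "finite B" "B \<subseteq> carrier M"
    and span: "\<forall>x\<in>carrier M. \<exists>c :: 'm \<Rightarrow> 'k. x = (\<Oplus>\<^bsub>M\<^esub>b\<in>B. (c b \<odot>\<^bsub>A\<^esub> \<one>\<^bsub>A\<^esub>) \<odot>\<^bsub>M\<^esub> b)"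
    using M by (auto simp: fin_dim_indec_module_def fin_dim_module_def)
  obtain c :: "'m \<Rightarrow> 'm \<Rightarrow> 'k"
    where c: "\<And>x. x \<in> carrier M \<Longrightarrow> x = (\<Oplus>\<^bsub>M\<^esub>b\<in>B. (c x b \<odot>\<^bsub>A\<^esub> \<one>\<^bsub>A\<^esub>) \<odot>\<^bsub>M\<^esub> b)"
    using span by metis
  obtain e :: "'m \<Rightarrow> nat" where e: "inj_on e B"
    using finite_imp_inj_to_nat_seg[OF B(1)] by auto
  define h :: "'m \<Rightarrow> nat \<Rightarrow> 'k" where "h x n = c x (inv_into B e n)" for x n
  have inj: "inj_on h (carrier M)"
  proof (rule inj_onI)
    have rep: "z = (\<Oplus>\<^bsub>M\<^esub>b\<in>B. (h z (e b) \<odot>\<^bsub>A\<^esub> \<one>\<^bsub>A\<^esub>) \<odot>\<^bsub>M\<^esub> b)" if z: "z \<in> carrier M" for z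
      by (subst c[OF z], rule L.M.finsum_cong')
         (use B sc e L.act_closed in \<open>auto simp: h_def subset_iff\<close>)
    fix x y assume "x \<in> carrier M" "y \<in> carrier M" "h x = h y"
    thus "x = y" using rep[of x] rep[of y] by simp
  qed
  define g where "g = inv_into (carrier M) h"
  have gh: "g (h x) = x" if "x \<in> carrier M" for x using inj that by (simp add: g_def)
  define M' :: "('a, nat \<Rightarrow> 'k) module" where
    "M' = \<lparr>carrier = h ` carrier M, monoid.mult = (\<lambda>x y. x), one = h \<zero>\<^bsub>M\<^esub>, ring.zero = h \<zero>\<^bsub>M\<^esub>,
       add = (\<lambda>x y. h (g x \<oplus>\<^bsub>M\<^esub> g y)), module.smult = (\<lambda>a x. h (a \<odot>\<^bsub>M\<^esub> g x))\<rparr>"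
  have "abelian_group M'"
  proof (rule abelian_groupI)
    fix x assume "x \<in> carrier M'"
    then obtain u where u: "u \<in> carrier M" "x = h u" by (auto simp: M'_def)
    show "\<exists>y\<in>carrier M'. y \<oplus>\<^bsub>M'\<^esub> x = \<zero>\<^bsub>M'\<^esub>"
      by (rule bexI[of _ "h (\<ominus>\<^bsub>M\<^esub> u)"]) (use u in \<open>auto simp: M'_def gh L.M.l_neg\<close>)
  qed (auto simp: M'_def gh L.M.a_assoc intro!: arg_cong[where f = h] intro: L.M.a_comm)
  then have L': "left_module A M'"
    by (intro left_module.intro left_module_axioms.intro L.A.ring_axioms)
       (auto simp: M'_def gh L.act_closed L.act_l_distr L.act_r_distr L.act_assoc L.act_one)
  have h: "h \<in> module_iso A M M'"
    using inj by (auto simp: module_iso_def M'_def gh bij_betw_def)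
  show ?thesis
    using fin_dim_indec_module_iso[OF A L' M h] h by (auto simp: fin_dim_indec_modules_def)
qed

lemma module_iso_rel_equiv: "equiv (fin_dim_indec_modules A) (module_iso_rel A)"
proof (rule equivI)
  show "module_iso_rel A \<subseteq> fin_dim_indec_modules A \<times> fin_dim_indec_modules A"
    by (auto simp: module_iso_rel_def)
  show "refl_on (fin_dim_indec_modules A) (module_iso_rel A)"
  proof (rule refl_onI)
    fix M assume "M \<in> fin_dim_indec_modules A"
    moreover have "id \<in> module_iso A M M" by (simp add: module_iso_def)
    ultimately show "(M, M) \<in> module_iso_rel A" by (auto simp: module_iso_rel_def)
  qed
  show "sym (module_iso_rel A)"
  proof (rule symI)
    fix M N assume MN: "(M, N) \<in> module_iso_rel A"
    then obtain h where h: "h \<in> module_iso A M N" by (auto simp: module_iso_rel_def)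
    interpret left_module A M
      using MN by (auto simp: module_iso_rel_def fin_dim_indec_modules_def fin_dim_indec_module_def)
    define g where "g = inv_into (carrier M) h"
    have bij: "bij_betw h (carrier M) (carrier N)" using h by (simp add: module_iso_def)
    have gh: "g (h x) = x" if "x \<in> carrier M" for x
      using bij that by (simp add: g_def bij_betw_def)
    have ex: "\<exists>x\<in>carrier M. y = h x" if "y \<in> carrier N" for y
      using bij that by (auto simp: bij_betw_def)
    have "g \<in> module_iso A N M"
      unfolding module_iso_def
    proof (intro CollectI conjI ballI)
      show "bij_betw g (carrier N) (carrier M)"
        unfolding g_def using bij by (rule bij_betw_inv_into)
      fix y z assume "y \<in> carrier N" "z \<in> carrier N"
      then obtain u v where uv: "u \<in> carrier M" "v \<in> carrier M" "y = h u" "z = h v" using ex by blast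
      hence "h u \<oplus>\<^bsub>N\<^esub> h v = h (u \<oplus>\<^bsub>M\<^esub> v)" using h by (simp add: module_iso_def)
      thus "g (y \<oplus>\<^bsub>N\<^esub> z) = g y \<oplus>\<^bsub>M\<^esub> g z" using uv by (simp add: gh)
    next
      fix a y assume a: "a \<in> carrier A" and "y \<in> carrier N"
      then obtain u where u: "u \<in> carrier M" "y = h u" using ex by blast
      hence "a \<odot>\<^bsub>N\<^esub> h u = h (a \<odot>\<^bsub>M\<^esub> u)" using h a by (simp add: module_iso_def)
      thus "g (a \<odot>\<^bsub>N\<^esub> y) = a \<odot>\<^bsub>M\<^esub> g y" using u a by (simp add: gh act_closed)
    qed
    thus "(N, M) \<in> module_iso_rel A" using MN by (auto simp: module_iso_rel_def)
  qed
  show "trans (module_iso_rel A)"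
  proof (rule transI)
    fix L M N assume LM: "(L, M) \<in> module_iso_rel A" and MN: "(M, N) \<in> module_iso_rel A"
    then obtain h g where h: "h \<in> module_iso A L M" and g: "g \<in> module_iso A M N"
      by (auto simp: module_iso_rel_def)
    have "h x \<in> carrier M" if "x \<in> carrier L" for x
      using h that by (auto simp: module_iso_def bij_betw_def)
    hence "g \<circ> h \<in> module_iso A L N"
      using h g by (auto simp: module_iso_def intro: bij_betw_trans)
    thus "(L, N) \<in> module_iso_rel A" using LM MN by (auto simp: module_iso_rel_def)
  qed
qed

end

theory Submission
  imports Defs "HOL-Library.Function_Algebras"
begin

text \<open>
  The squares of \<open>g\<^sub>1\<close> and \<open>g\<^sub>2\<close> are central, and modulo \<open>g\<^sub>1\<^sup>2 = g\<^sub>2\<^sup>2 = 1\<close> the right-hand sides of the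
  deformed relations vanish, so \<open>\<lambda>\<close> disappears. Killing also all products \<open>a\<^sub>i a\<^sub>j\<close> leaves a
  radical-square-zero algebra over \<open>k[\<int>/2 \<times> \<int>/2]\<close> whose separated quiver contains a cycle of type
  \<open>\<tilde>A\<^sub>3\<close>. Placing the parameter \<open>t\<close> on one arrow of this cycle, and one-dimensional spaces at its
  vertices, gives pairwise non-isomorphic indecomposable modules indexed by the infinite field.
\<close>

section \<open>Modules over presented algebras from linear operators\<close>

text \<open>With \<open>foldr\<close> the last letter acts first, so concatenation becomes
  composition, as a left module requires.\<close>

fun word_act :: "('g \<Rightarrow> 'v \<Rightarrow> 'v) \<Rightarrow> 'g fmon \<Rightarrow> 'v \<Rightarrow> 'v" where
  "word_act r (Word w) = foldr r w"

lemma word_act_zero [simp]: "word_act r 0 x = x"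
  by (simp add: zero_fmon_def)

lemma word_act_plus: "word_act r (u + v) x = word_act r u (word_act r v x)"
  by (cases u; cases v) simp

text \<open>Turns \<open>update_induct\<close> into an induction that adds one monomial at a
  time.\<close>

lemma poly_mapping_update_eq_plus:
  assumes "a \<notin> Poly_Mapping.keys f"
  shows "Poly_Mapping.update a b f = f + Poly_Mapping.single a b"
  using assms
  by (intro poly_mapping_eqI) (auto simp: lookup_update lookup_add lookup_single in_keys_iff when_def)

section \<open>Cosets in the quotient of the free algebra\<close>

lemma ring_of_type_algebra_simps [simp]:
  "carrier ring_of_type_algebra = UNIV" "monoid.mult ring_of_type_algebra = (*)"
  "one ring_of_type_algebra = 1" "ring.zero ring_of_type_algebra = 0"
  "add ring_of_type_algebra = (+)"
  by (simp_all add: ring_of_type_algebra_def)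

lemma a_inv_ring_of_type_algebra [simp]: "\<ominus>\<^bsub>ring_of_type_algebra\<^esub> x = - (x :: 'a::ring_1)"
proof -
  interpret ring "ring_of_type_algebra :: 'a ring" by (rule ring_of_type)
  show ?thesis by (rule minus_equality) simp_all
qed

lemma ideal_ring_of_type_algebraI:
  fixes J :: "'a::ring_1 set"
  assumes "0 \<in> J" "\<And>x y. x \<in> J \<Longrightarrow> y \<in> J \<Longrightarrow> x + y \<in> J" "\<And>x. x \<in> J \<Longrightarrow> - x \<in> J"
    and "\<And>x y. x \<in> J \<Longrightarrow> y * x \<in> J" "\<And>x y. x \<in> J \<Longrightarrow> x * y \<in> J"
  shows "ideal J ring_of_type_algebra"
proof -
  interpret ring "ring_of_type_algebra :: 'a ring" by (rule ring_of_type)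
  have "subgroup J (add_monoid ring_of_type_algebra)"
    using assms by (intro add.subgroupI) (auto simp flip: a_inv_def)
  with assms show ?thesis by (intro idealI ring_of_type) auto
qed

abbreviation free_ring :: "('g, 'k::field) free_alg ring" where
  "free_ring \<equiv> ring_of_type_algebra"

definition relation_class :: "(('g, 'k::field) free_alg \<times> ('g, 'k) free_alg) set \<Rightarrow>
    ('g, 'k) free_alg \<Rightarrow> ('g, 'k) free_alg set" where
  "relation_class S p = presented_ideal S +>\<^bsub>free_ring\<^esub> p"

lemma mem_relation_class_iff: "q \<in> relation_class S p \<longleftrightarrow> q - p \<in> presented_ideal S"
  by (auto simp: relation_class_def a_r_coset_def r_coset_def) (metis diff_add_cancel)

lemma relation_class_self: "p \<in> relation_class S p"
proof -
  interpret ideal "presented_ideal S" free_ring by (rule presented_ideal_ideal)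
  show ?thesis using a_rcos_self[of p] by (simp add: relation_class_def)
qed

text \<open>Ideal cosets multiply and add by representatives, so all later work takes place in the
  free algebra.\<close>

lemma presented_algebra_simps:
  "carrier (presented_algebra S) = range (relation_class S)"
  "relation_class S p \<otimes>\<^bsub>presented_algebra S\<^esub> relation_class S q = relation_class S (p * q)"
  "relation_class S p \<oplus>\<^bsub>presented_algebra S\<^esub> relation_class S q = relation_class S (p + q)"
  "\<one>\<^bsub>presented_algebra S\<^esub> = relation_class S 1"
  "c \<odot>\<^bsub>presented_algebra S\<^esub> relation_class S p = relation_class S (scalar c * p)"
proof -
  interpret ideal "presented_ideal S" free_ring by (rule presented_ideal_ideal)
  note defs = relation_class_def presented_algebra_def Let_def FactRing_def
  show "carrier (presented_algebra S) = range (relation_class S)"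
    by (auto simp: defs A_RCOSETS_defs a_r_coset_def r_coset_def)
  show "relation_class S p \<otimes>\<^bsub>presented_algebra S\<^esub> relation_class S q = relation_class S (p * q)"
    "c \<odot>\<^bsub>presented_algebra S\<^esub> relation_class S p = relation_class S (scalar c * p)"
    using rcoset_mult_add[of p q] rcoset_mult_add[of "scalar c" p] by (simp_all add: defs)
  show "relation_class S p \<oplus>\<^bsub>presented_algebra S\<^esub> relation_class S q = relation_class S (p + q)"
    using a_rcos_sum[of p q] by (simp add: defs)
  show "\<one>\<^bsub>presented_algebra S\<^esub> = relation_class S 1"
    by (simp add: defs)
qed

section \<open>Actions of the free algebra\<close>

text \<open>Universal property of the free algebra: any choice of linear operators for the
  generators extends to an action.\<close>

locale free_alg_rep = vector_space scale
  for scale :: "'k::field \<Rightarrow> 'v::ab_group_add \<Rightarrow> 'v" (infixr \<open>*s\<close> 75) +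
  fixes r :: "'g \<Rightarrow> 'v \<Rightarrow> 'v"
  assumes gen_add: "r g (x + y) = r g x + r g y"
    and gen_scale: "r g (c *s x) = c *s r g x"
begin

definition act :: "('g, 'k) free_alg \<Rightarrow> 'v \<Rightarrow> 'v" where
  "act p x = (\<Sum>w\<in>Poly_Mapping.keys p. Poly_Mapping.lookup p w *s word_act r w x)"

lemma word_act_add: "word_act r w (x + y) = word_act r w x + word_act r w y"
proof (cases w)
  case (Word l)
  show ?thesis unfolding Word by (induction l) (simp_all add: gen_add)
qed

lemma word_act_scale: "word_act r w (c *s x) = c *s word_act r w x"
proof (cases w)
  case (Word l)
  show ?thesis unfolding Word by (induction l) (simp_all add: gen_scale)
qed

lemma word_act_0_right [simp]: "word_act r w 0 = 0"
  using word_act_add[of w 0 0] by simp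

text \<open>Coefficients vanish off the support, so sums for different polynomials can be taken over
  one common index set.\<close>

lemma act_superset:
  assumes "finite K" "Poly_Mapping.keys p \<subseteq> K"
  shows "act p x = (\<Sum>w\<in>K. Poly_Mapping.lookup p w *s word_act r w x)"
  unfolding act_def using assms by (intro sum.mono_neutral_left) (auto simp: in_keys_iff)

lemma act_plus: "act (p + q) x = act p x + act q x"
proof -
  define K where "K = Poly_Mapping.keys p \<union> Poly_Mapping.keys q"
  have K: "finite K" "Poly_Mapping.keys p \<subseteq> K" "Poly_Mapping.keys q \<subseteq> K" "Poly_Mapping.keys (p + q) \<subseteq> K"
    using Poly_Mapping.keys_add[of p q] by (auto simp: K_def)
  show ?thesis
    by (simp add: act_superset[OF K(1)] K lookup_add scale_left_distrib sum.distrib)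
qed

lemma act_single: "act (Poly_Mapping.single w c) x = c *s word_act r w x"
  by (subst act_superset[of "{w}"]) auto

lemma act_add: "act p (x + y) = act p x + act p y"
  by (simp add: act_def word_act_add scale_right_distrib sum.distrib)

lemma act_scale: "act p (c *s x) = c *s act p x"
  by (simp add: act_def word_act_scale scale_sum_right mult.commute)

lemma act_0 [simp]: "act 0 x = 0"
  by (simp add: act_def)

lemma act_uminus: "act (- p) x = - act p x"
  using act_plus[of "- p" p x] by (simp add: eq_neg_iff_add_eq_0)

lemma act_minus: "act (p - q) x = act p x - act q x"
  using act_plus[of p "- q" x] by (simp add: act_uminus)

lemma act_0_right [simp]: "act p 0 = 0"
  using act_add[of p 0 0] by simp

lemma act_gen [simp]: "act (gen g) x = r g x"
  by (simp add: gen_def act_single)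

lemma act_scalar [simp]: "act (scalar c) x = c *s x"
  by (simp add: scalar_def act_single)

lemma act_one [simp]: "act 1 x = x"
  using act_scalar[of 1 x] by (simp add: scalar_def del: act_scalar)

text \<open>Multiplicativity is split in two: induction on the right factor here, on the left factor
  in \<open>act_times\<close>.\<close>

lemma act_single_times: "act (Poly_Mapping.single w c * q) x = c *s word_act r w (act q x)"
proof (induction q rule: update_induct)
  case const
  show ?case by simp
next
  case (update f a b)
  then show ?case
    by (simp add: poly_mapping_update_eq_plus distrib_left act_plus mult_single act_single
        word_act_plus word_act_add word_act_scale scale_right_distrib)
qed

lemma act_times: "act (p * q) x = act p (act q x)"
proof (induction p rule: update_induct)
  case (update f a b)
  then show ?case
    by (simp add: poly_mapping_update_eq_plus distrib_right act_plus act_single_times act_single)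
qed simp

lemma act_power_id:
  assumes "\<And>x. act p x = x"
  shows "act (p ^ n) x = x"
  by (induction n) (simp_all add: act_times assms)

end

section \<open>Modules over the presented algebra\<close>

text \<open>The invariant subspace \<open>W\<close> is separate from the type \<open>'v\<close>, so
  that a finite-dimensional module can live in an infinite-dimensional function space.\<close>

locale presented_rep = free_alg_rep scale r
  for scale :: "'k::field \<Rightarrow> 'v::ab_group_add \<Rightarrow> 'v" (infixr \<open>*s\<close> 75) and r :: "'g \<Rightarrow> 'v \<Rightarrow> 'v" +
  fixes W :: "'v set" and S :: "(('g, 'k) free_alg \<times> ('g, 'k) free_alg) set"
  assumes subspace_W: "subspace W"
    and gen_W: "x \<in> W \<Longrightarrow> r g x \<in> W"
    and relations: "(p, q) \<in> S \<Longrightarrow> x \<in> W \<Longrightarrow> act p x = act q x"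
begin

abbreviation A :: "('k, ('g, 'k) free_alg set) module" where "A \<equiv> presented_algebra S"

text \<open>A coset acts through an arbitrary representative; \<open>smult_relation_class\<close>
  shows that on \<open>W\<close> the choice is immaterial. The ring components are
  placeholders.\<close>

definition rep_module :: "(('g, 'k) free_alg set, 'v) module" where
  "rep_module = \<lparr>carrier = W, monoid.mult = (\<lambda>x y. x), one = 0, ring.zero = 0, add = (+),
     module.smult = (\<lambda>C. act (SOME p. p \<in> C))\<rparr>"

lemma act_W: "x \<in> W \<Longrightarrow> act p x \<in> W"
proof -
  assume x: "x \<in> W"
  have "word_act r w x \<in> W" for w
  proof (cases w)
    case (Word l)
    show ?thesis unfolding Word by (induction l) (simp_all add: x gen_W)
  qed
  then show ?thesis
    unfolding act_def by (intro subspace_sum subspace_W subspace_scale)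
qed

text \<open>The annihilator of \<open>W\<close> is a two-sided ideal, by invariance of
  \<open>W\<close>, and contains every difference \<open>p - q\<close> of a relation, hence the
  ideal they generate.\<close>

lemma act_presented_ideal:
  assumes "p \<in> presented_ideal S" "x \<in> W"
  shows "act p x = 0"
proof -
  have "ideal {p. \<forall>x\<in>W. act p x = 0} free_ring"
    by (rule ideal_ring_of_type_algebraI) (simp_all add: act_plus act_uminus act_times act_W)
  moreover have "{p - q | p q. (p, q) \<in> S} \<subseteq> {p. \<forall>x\<in>W. act p x = 0}"
    by (auto simp: act_minus relations)
  ultimately have "presented_ideal S \<subseteq> {p. \<forall>x\<in>W. act p x = 0}"
    unfolding presented_ideal_def
    by (intro ring.genideal_minimal ring_of_type)
  with assms show ?thesis by auto
qed

lemma smult_relation_class: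
  assumes "x \<in> W"
  shows "relation_class S p \<odot>\<^bsub>rep_module\<^esub> x = act p x"
proof -
  have "(SOME q. q \<in> relation_class S p) \<in> relation_class S p"
    using relation_class_self by (rule someI)
  then have "act ((SOME q. q \<in> relation_class S p) - p) x = 0"
    by (intro act_presented_ideal assms) (simp add: mem_relation_class_iff)
  then show ?thesis by (simp add: rep_module_def act_minus)
qed

lemma rep_module_simps [simp]:
  "carrier rep_module = W" "add rep_module = (+)" "ring.zero rep_module = 0"
  by (simp_all add: rep_module_def)

lemma abelian_group_rep_module: "abelian_group rep_module"
proof (rule abelian_groupI)
  fix x assume "x \<in> carrier rep_module"
  then have "- x \<in> W" by (simp add: subspace_W subspace_neg)
  then show "\<exists>y\<in>carrier rep_module. y \<oplus>\<^bsub>rep_module\<^esub> x = \<zero>\<^bsub>rep_module\<^esub>"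
    by (intro bexI[of _ "- x"]) simp_all
qed (simp_all add: subspace_W subspace_add subspace_0 add.assoc add.commute)

lemma left_module_rep_module: "left_module A rep_module"
proof (intro left_module.intro left_module_axioms.intro abelian_group_rep_module)
  show "ring A"
    using presented_algebra_assoc_algebra[of S] by (simp add: assoc_algebra_def)
qed (auto simp: presented_algebra_simps smult_relation_class act_W act_plus act_add act_times
    subspace_W subspace_add)

lemma finsum_rep_module:
  assumes "finite B" "\<And>b. b \<in> B \<Longrightarrow> f b \<in> W"
  shows "(\<Oplus>\<^bsub>rep_module\<^esub>b\<in>B. f b) = (\<Sum>b\<in>B. f b)"
proof -
  interpret abelian_group rep_module by (rule abelian_group_rep_module)
  show ?thesis using assms by (induction B) (simp_all add: Pi_def)
qed

lemma fin_dim_rep_module: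
  assumes "finite B" "span B = W"
  shows "fin_dim_module A rep_module"
  unfolding fin_dim_module_def
proof (intro exI[of _ B] conjI ballI)
  show BW: "B \<subseteq> carrier rep_module" using assms(2) span_superset by auto
  fix x assume "x \<in> carrier rep_module"
  then obtain u where u: "x = (\<Sum>v\<in>B. u v *s v)"
    using assms by (auto simp: span_finite)
  have "(\<Oplus>\<^bsub>rep_module\<^esub>b\<in>B. (u b \<odot>\<^bsub>A\<^esub> \<one>\<^bsub>A\<^esub>) \<odot>\<^bsub>rep_module\<^esub> b) = (\<Sum>b\<in>B. (u b \<odot>\<^bsub>A\<^esub> \<one>\<^bsub>A\<^esub>) \<odot>\<^bsub>rep_module\<^esub> b)"
    using BW by (intro finsum_rep_module assms)
      (auto simp: presented_algebra_simps smult_relation_class subspace_W subspace_scale subset_iff)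
  also have "\<dots> = x"
    unfolding u using BW by (intro sum.cong) (auto simp: presented_algebra_simps smult_relation_class)
  finally show "\<exists>c. x = (\<Oplus>\<^bsub>rep_module\<^esub>b\<in>B. (c b \<odot>\<^bsub>A\<^esub> \<one>\<^bsub>A\<^esub>) \<odot>\<^bsub>rep_module\<^esub> b)"
    by (intro exI[of _ u]) (rule sym)
qed (rule assms)

text \<open>Scalars and generators both act as algebra elements, so closure under the action yields
  both linearity and invariance.\<close>

lemma submodule_rep_module:
  assumes "submodule U A rep_module"
  shows "U \<subseteq> W" "subspace U" "x \<in> U \<Longrightarrow> r g x \<in> U"
proof -
  interpret submodule U A rep_module by (rule assms)
  show UW: "U \<subseteq> W" using subset by simp
  have act_U: "act p x \<in> U" if "x \<in> U" for p x
  proof -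
    have "x \<in> W" using that UW by blast
    then show ?thesis
      using smult_closed[of "relation_class S p" x] that
      by (simp add: presented_algebra_simps smult_relation_class)
  qed
  show "x \<in> U \<Longrightarrow> r g x \<in> U" using act_U[of x "gen g"] by simp
  show "subspace U"
  proof (rule subspaceI)
    show "0 \<in> U" using one_closed by simp
    show "x + y \<in> U" if "x \<in> U" "y \<in> U" for x y using m_closed that by simp
    show "c *s x \<in> U" if "x \<in> U" for c x using act_U[of x "scalar c"] that by simp
  qed
qed

end

text \<open>An isomorphism commutes with the action of every polynomial; \<open>scalar c\<close> and
  \<open>gen g\<close> are the cases of interest.\<close>

lemma rep_module_iso:
  assumes R: "presented_rep scale r W S" and R': "presented_rep scale' r' W' S"
    and h: "h \<in> module_iso (presented_algebra S) (presented_rep.rep_module scale r W)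
      (presented_rep.rep_module scale' r' W')"
  shows "bij_betw h W W'"
    and "x \<in> W \<Longrightarrow> y \<in> W \<Longrightarrow> h (x + y) = h x + h y"
    and "x \<in> W \<Longrightarrow> h (scale c x) = scale' c (h x)"
    and "x \<in> W \<Longrightarrow> h (r g x) = r' g (h x)"
proof -
  interpret R: presented_rep scale r W S by (rule R)
  interpret R': presented_rep scale' r' W' S by (rule R')
  show bij: "bij_betw h W W'" using h by (simp add: module_iso_def)
  show "x \<in> W \<Longrightarrow> y \<in> W \<Longrightarrow> h (x + y) = h x + h y"
    using h by (simp add: module_iso_def)
  have h_act: "h (R.act p x) = R'.act p (h x)" if "x \<in> W" for p x
  proof -
    have "h x \<in> W'" using bij that by (auto simp: bij_betw_def)
    moreover have "h (relation_class S p \<odot>\<^bsub>R.rep_module\<^esub> x) = relation_class S p \<odot>\<^bsub>R'.rep_module\<^esub> h x"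
      using h that by (auto simp: module_iso_def presented_algebra_simps)
    ultimately show ?thesis using that by (simp add: R.smult_relation_class R'.smult_relation_class)
  qed
  show "x \<in> W \<Longrightarrow> h (scale c x) = scale' c (h x)" using h_act[of x "scalar c"] by simp
  show "x \<in> W \<Longrightarrow> h (r g x) = r' g (h x)" using h_act[of x "gen g"] by simp
qed


section \<open>A one-parameter family of indecomposable modules\<close>

definition fun_scale :: "'k::field \<Rightarrow> (nat \<Rightarrow> 'k) \<Rightarrow> nat \<Rightarrow> 'k" where
  "fun_scale c f n = c * f n"

text \<open>A copy of \<open>k^4\<close> inside the element type that
  \<open>fin_dim_indec_modules\<close> prescribes.\<close>

definition coord4 :: "(nat \<Rightarrow> 'k::field) set" where
  "coord4 = {f. \<forall>n\<ge>4. f n = 0}"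

definition unit_vec :: "nat \<Rightarrow> nat \<Rightarrow> 'k::field" where
  "unit_vec i n = (if n = i then 1 else 0)"

text \<open>
  The unit vectors \<open>0, 1, 2, 3\<close> are eigenvectors of \<open>(g\<^sub>1, g\<^sub>2)\<close> with signs
  \<open>++, +-, -+, --\<close>; both \<open>a\<^sub>1\<close> and \<open>a\<^sub>2\<close> map the first two into the span of the last two.
\<close>

fun cycle_rep :: "'k::field \<Rightarrow> generator \<Rightarrow> (nat \<Rightarrow> 'k) \<Rightarrow> nat \<Rightarrow> 'k" where
  "cycle_rep t G1 f = (\<lambda>n. if n = 2 \<or> n = 3 then - f n else f n)"
| "cycle_rep t G2 f = (\<lambda>n. if n = 1 \<or> n = 3 then - f n else f n)"
| "cycle_rep t A1 f = (\<lambda>n. if n = 2 then f 0 else if n = 3 then f 1 else 0)"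
| "cycle_rep t A2 f = (\<lambda>n. if n = 2 then t * f 1 else if n = 3 then f 0 else 0)"

lemma vector_space_fun_scale: "vector_space fun_scale"
  by unfold_locales (auto simp: fun_scale_def fun_eq_iff algebra_simps)

interpretation V: vector_space "fun_scale :: 'k::field \<Rightarrow> _"
  by (rule vector_space_fun_scale)

lemma subspace_coord4: "V.subspace coord4"
  by (rule V.subspaceI) (auto simp: coord4_def fun_scale_def)

lemma span_unit_vec: "V.span (unit_vec ` {..<4}) = (coord4 :: (nat \<Rightarrow> 'k::field) set)"
proof (rule V.span_subspace[OF _ _ subspace_coord4])
  show "unit_vec ` {..<4} \<subseteq> coord4" by (auto simp: coord4_def unit_vec_def)
  show "(coord4 :: (nat \<Rightarrow> 'k) set) \<subseteq> V.span (unit_vec ` {..<4})"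
  proof
    fix f :: "nat \<Rightarrow> 'k" assume f: "f \<in> coord4"
    have eq: "f = fun_scale (f 0) (unit_vec 0) + fun_scale (f 1) (unit_vec 1)
        + fun_scale (f 2) (unit_vec 2) + fun_scale (f 3) (unit_vec 3)"
    proof (rule ext)
      fix n :: nat
      have "n = 0 \<or> n = 1 \<or> n = 2 \<or> n = 3 \<or> 4 \<le> n" by linarith
      then show "f n = (fun_scale (f 0) (unit_vec 0) + fun_scale (f 1) (unit_vec 1)
        + fun_scale (f 2) (unit_vec 2) + fun_scale (f 3) (unit_vec 3)) n"
        using f by (auto simp: coord4_def fun_scale_def unit_vec_def)
    qed
    show "f \<in> V.span (unit_vec ` {..<4})"
      by (subst eq) (intro V.span_add V.span_scale V.span_base imageI, simp_all)
  qed
qed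

interpretation C: free_alg_rep fun_scale "cycle_rep t" for t :: "'k::field"
proof
  fix g x y c
  show "cycle_rep t g (x + y) = cycle_rep t g x + cycle_rep t g y"
    by (cases g) (auto simp: algebra_simps)
  show "cycle_rep t g (fun_scale c x) = fun_scale c (cycle_rep t g x)"
    by (cases g) (auto simp: fun_scale_def)
qed

text \<open>\<open>A1\<close> and \<open>A2\<close> read only coordinates 0, 1 and write only 2, 3,
  so their products act as zero. The sign relations hold because \<open>A1\<close> flips the sign of
  \<open>g1\<close> only and \<open>A2\<close> flips both signs.\<close>

lemma cycle_rep_relations:
  assumes "(p, q) \<in> H_relations N M l1 l2 l3"
  shows "C.act t p x = C.act t q x"
proof -
  note act_simps = C.act_times C.act_plus C.act_minus C.act_uminus
  have sq: "C.act t (gen G1 ^ 2) x = x" "C.act t (gen G2 ^ 2) x = x" for x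
    by (auto simp: power2_eq_square act_simps)
  have pow: "C.act t (gen G1 ^ (2 * N)) x = x" "C.act t (gen G2 ^ (2 * M)) x = x"
    using C.act_power_id[of t "gen G1 ^ 2" N x] C.act_power_id[of t "gen G2 ^ 2" M x] sq
    by (simp_all add: power_mult)
  have nil: "C.act t (gen A1 ^ 2) x = 0" "C.act t (gen A2 ^ 2) x = 0"
    by (auto simp: power2_eq_square act_simps)
  have zero: "fun_scale c 0 = 0" for c :: 'a
    by (auto simp: fun_scale_def)
  show ?thesis
    using assms unfolding H_relations_def Let_def
    by (auto simp: pow nil sq act_simps zero)
qed

interpretation P: presented_rep fun_scale "cycle_rep t" coord4 "H_relations N M l1 l2 l3"
  for t l1 l2 l3 :: "'k::field" and N M :: nat
proof
  show "cycle_rep t g x \<in> coord4" if "x \<in> coord4" for g x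
    using that by (cases g) (auto simp: coord4_def)
qed (auto intro: subspace_coord4 cycle_rep_relations)

abbreviation cycle_module :: "'k::field \<Rightarrow> ((generator, 'k) free_alg set, nat \<Rightarrow> 'k) module" where
  "cycle_module t \<equiv> presented_rep.rep_module fun_scale (cycle_rep t) coord4"

section \<open>Indecomposability\<close>

lemma unit_vec_coord4: "i < 4 \<Longrightarrow> unit_vec i \<in> coord4"
  by (auto simp: coord4_def unit_vec_def)

lemma cycle_rep_unit_vec:
  "cycle_rep t A1 (unit_vec 0) = unit_vec 2" "cycle_rep t A1 (unit_vec 1) = unit_vec 3"
  "cycle_rep t A2 (unit_vec 0) = unit_vec 3" "cycle_rep t A2 (unit_vec 1) = fun_scale t (unit_vec 2)"
  by (auto simp: unit_vec_def fun_scale_def)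

lemma unit_vec_neq_0: "unit_vec i \<noteq> 0"
  by (metis unit_vec_def zero_fun_apply zero_neq_one)

text \<open>The projection onto a common eigenspace of \<open>g\<^sub>1\<close> and \<open>g\<^sub>2\<close> is a polynomial in them.\<close>

lemma unit_vec_mem_subspace:
  fixes U :: "(nat \<Rightarrow> 'k::field_char_0) set"
  assumes U: "V.subspace U" and inv: "\<And>g x. x \<in> U \<Longrightarrow> cycle_rep t g x \<in> U"
    and x: "x \<in> U" "x \<in> coord4" and i: "i < 4" "x i \<noteq> 0"
  shows "unit_vec i \<in> U"
proof -
  \<comment> \<open>\<open>s1\<close> and \<open>s2\<close> are the eigenvalues of \<open>G1\<close>
    and \<open>G2\<close> on \<open>unit_vec i\<close>. Applying \<open>1 + s1 G1\<close> and then
    \<open>1 + s2 G2\<close> gives four times the projection, whence the factor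
    \<open>1 / (4 * x i)\<close>.\<close>
  define s1 s2 :: 'k where "s1 = (if i < 2 then 1 else -1)" and "s2 = (if even i then 1 else -1)"
  define y where "y = x + fun_scale s1 (cycle_rep t G1 x)"
  define z where "z = y + fun_scale s2 (cycle_rep t G2 y)"
  have y: "y \<in> U" unfolding y_def by (intro V.subspace_add V.subspace_scale U inv x)
  have "z \<in> U" unfolding z_def by (intro V.subspace_add V.subspace_scale U inv y)
  then have "fun_scale (1 / (4 * x i)) z \<in> U" by (intro V.subspace_scale U)
  moreover have "fun_scale (1 / (4 * x i)) z = unit_vec i"
  proof (rule ext)
    fix n :: nat
    have n: "n = 0 \<or> n = 1 \<or> n = 2 \<or> n = 3 \<or> 4 \<le> n" by linarith
    have "i = 0 \<or> i = 1 \<or> i = 2 \<or> i = 3" using i by linarith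
    then show "fun_scale (1 / (4 * x i)) z n = unit_vec i n"
      using n x(2) i(2)
      by (elim disjE) (simp_all add: coord4_def z_def y_def s1_def s2_def fun_scale_def unit_vec_def)
  qed
  ultimately show ?thesis by simp
qed

text \<open>The summand containing vector 0 contains its images 2 and 3. Vector 1 cannot lie in the
  other summand, since \<open>A1\<close> sends it to 3. Only arrows of weight 1 are followed, so
  \<open>t = 0\<close> is covered.\<close>

lemma indecomposable_cycle_module:
  fixes t :: "'k::field_char_0"
  shows "indecomposable_module (H_alg N M l1 l2 l3) (cycle_module t)"
  unfolding indecomposable_module_def P.rep_module_simps
proof (intro conjI allI impI)
  show "coord4 \<noteq> {0 :: nat \<Rightarrow> 'k}"
    using unit_vec_coord4[of 0] unit_vec_neq_0[of 0] by auto
  have mem: "unit_vec i \<in> U \<or> unit_vec i \<in> V"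
    if "submodule U (H_alg N M l1 l2 l3) (cycle_module t)"
      "submodule V (H_alg N M l1 l2 l3) (cycle_module t)"
      "U <+>\<^bsub>cycle_module t\<^esub> V = coord4" "i < 4" for U V i
  proof -
    have "(unit_vec i :: nat \<Rightarrow> 'k) \<in> U <+>\<^bsub>cycle_module t\<^esub> V"
      using that unit_vec_coord4 by simp
    then obtain u v where uv: "u \<in> U" "v \<in> V" "unit_vec i = u + v"
      by (auto simp: set_add_def set_mult_def)
    \<comment> \<open>One component has a nonzero coordinate \<open>i\<close>, and projecting it
      onto the eigenspace puts \<open>unit_vec i\<close> into its summand.\<close>
    then have "u i + v i = 1" by (metis plus_fun_apply unit_vec_def)
    then have "u i \<noteq> 0 \<or> v i \<noteq> 0" by auto
    then show ?thesis
      using unit_vec_mem_subspace[of U t u i] unit_vec_mem_subspace[of V t v i] uv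
        P.submodule_rep_module[OF that(1)[unfolded H_alg_def]]
        P.submodule_rep_module[OF that(2)[unfolded H_alg_def]] \<open>i < 4\<close>
      by blast
  qed
  have triv: "V = {0}"
    if U: "submodule U (H_alg N M l1 l2 l3) (cycle_module t)"
      and V: "submodule V (H_alg N M l1 l2 l3) (cycle_module t)"
      and int: "U \<inter> V = {0}" and sum: "U <+>\<^bsub>cycle_module t\<^esub> V = coord4" and 0: "unit_vec 0 \<in> U" for U V
  proof -
    note subU = P.submodule_rep_module[OF U[unfolded H_alg_def]]
    note subV = P.submodule_rep_module[OF V[unfolded H_alg_def]]
    have 2: "unit_vec 2 \<in> U" and 3: "unit_vec 3 \<in> U"
      using subU(3)[OF 0, of A1] subU(3)[OF 0, of A2] by (simp_all only: cycle_rep_unit_vec)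
    have "unit_vec 1 \<notin> V"
    proof
      assume "unit_vec 1 \<in> V"
      from subV(3)[OF this, of A1] have "unit_vec 3 \<in> V" by (simp only: cycle_rep_unit_vec)
      with 3 int have "unit_vec 3 = (0 :: nat \<Rightarrow> 'k)" by blast
      then show False by (simp add: unit_vec_neq_0)
    qed
    with mem[OF U V sum, of 1] have 1: "unit_vec 1 \<in> U" by simp
    have "unit_vec ` {..<4} \<subseteq> U"
      using 0 1 2 3 by (auto simp: numeral_eq_Suc lessThan_Suc)
    then have "coord4 \<subseteq> U"
      using V.span_minimal[OF _ subU(2)] span_unit_vec by metis
    then show "V = {0}" using subV(1) int by blast
  qed
  fix U V
  assume UV: "submodule U (H_alg N M l1 l2 l3) (cycle_module t) \<and>
    submodule V (H_alg N M l1 l2 l3) (cycle_module t) \<and>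
    U \<inter> V = {0} \<and> U <+>\<^bsub>cycle_module t\<^esub> V = coord4"
  \<comment> \<open>\<open>triv\<close> is stated for the summand containing vector 0; commuting the
    sum handles the case where this is \<open>V\<close>.\<close>
  have "V <+>\<^bsub>cycle_module t\<^esub> U = U <+>\<^bsub>cycle_module t\<^esub> V"
    by (auto simp: set_add_def set_mult_def add.commute)
  with UV have "V <+>\<^bsub>cycle_module t\<^esub> U = coord4" by simp
  then show "U = {0} \<or> V = {0}"
    using triv[of U V] triv[of V U] mem[of U V 0] UV by (auto simp: Int_commute)
qed

section \<open>Distinguishing the modules\<close>

text \<open>The monodromy around the cycle is an invariant: the coefficient \<open>c\<close> of
  \<open>h\<close> at vector 0 is carried to vectors 1 and 2 along the arrows of weight 1, and the
  arrow from 1 to 2 then forces \<open>s * c = t * c\<close>.\<close>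

lemma cycle_module_iso_imp_eq:
  fixes s t :: "'k::field_char_0"
  assumes h: "h \<in> module_iso (H_alg N M l1 l2 l3) (cycle_module s) (cycle_module t)"
  shows "s = t"
proof -
  note iso = rep_module_iso[OF P.presented_rep_axioms P.presented_rep_axioms h[unfolded H_alg_def]]
  have W: "unit_vec 0 \<in> (coord4 :: (nat \<Rightarrow> 'k) set)" "unit_vec 1 \<in> (coord4 :: (nat \<Rightarrow> 'k) set)"
    "unit_vec 2 \<in> (coord4 :: (nat \<Rightarrow> 'k) set)"
    by (simp_all add: unit_vec_coord4)
  define c where "c = h (unit_vec 0) 0"
  have h2: "h (unit_vec 2) = cycle_rep t A1 (h (unit_vec 0))"
    using iso(4)[OF W(1), of A1] by (simp only: cycle_rep_unit_vec)
  have h3: "h (unit_vec 3) = cycle_rep t A2 (h (unit_vec 0))"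
    using iso(4)[OF W(1), of A2] by (simp only: cycle_rep_unit_vec)
  have h3': "h (unit_vec 3) = cycle_rep t A1 (h (unit_vec 1))"
    using iso(4)[OF W(2), of A1] by (simp only: cycle_rep_unit_vec)
  have s: "fun_scale s (h (unit_vec 2)) = cycle_rep t A2 (h (unit_vec 1))"
    using iso(4)[OF W(2), of A2] iso(3)[OF W(3), of s] by (simp only: cycle_rep_unit_vec)
  have "h (unit_vec 1) 1 = c"
    using fun_cong[OF h3, of 3] fun_cong[OF h3', of 3] by (simp add: c_def)
  then have "s * c = t * c"
    using fun_cong[OF s, of 2] fun_cong[OF h2, of 2] by (simp add: fun_scale_def c_def)
  \<comment> \<open>As \<open>G2\<close> fixes vector 0, its image has coordinate 1 equal to zero.
    If \<open>c = 0\<close> as well, \<open>A1\<close> kills this image, so \<open>h\<close> sends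
    vector 2 to zero, against injectivity.\<close>
  moreover have "c \<noteq> 0"
  proof
    assume "c = 0"
    have "cycle_rep s G2 (unit_vec 0) = unit_vec 0" by (auto simp: unit_vec_def)
    with iso(4)[OF W(1), of G2] have "h (unit_vec 0) = cycle_rep t G2 (h (unit_vec 0))" by simp
    from fun_cong[OF this, of 1] have "h (unit_vec 0) 1 = 0" by simp
    with \<open>c = 0\<close> h2 have "h (unit_vec 2) = 0" by (auto simp: c_def)
    moreover have "h 0 = 0"
      using iso(2)[of 0 0] V.subspace_0[OF subspace_coord4] by simp
    ultimately have "unit_vec 2 = (0 :: nat \<Rightarrow> 'k)"
      using iso(1) W(3) V.subspace_0[OF subspace_coord4] unfolding bij_betw_def
      by (metis inj_onD)
    then show False by (simp add: unit_vec_neq_0)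
  qed
  ultimately show "s = t" by simp
qed

lemma cycle_module_fin_dim_indec:
  fixes t :: "'k::field_char_0"
  shows "cycle_module t \<in> fin_dim_indec_modules (H_alg N M l1 l2 l3)"
  unfolding fin_dim_indec_modules_def fin_dim_indec_module_def
  using indecomposable_cycle_module P.left_module_rep_module
    P.fin_dim_rep_module[OF _ span_unit_vec]
  unfolding H_alg_def by blast

section \<open>Infinitely many isomorphism classes\<close>

theorem corollary5p3:
  fixes l1 l2 l3 :: "'k :: {alg_closed_field, field_char_0}"
    and N M :: nat
  assumes "N \<ge> 2" and "M \<ge> 2"
  shows "\<not> finite_representation_type (H_alg N M l1 l2 l3)"
proof
  define A where "A = H_alg N M l1 l2 l3"
  assume "finite_representation_type (H_alg N M l1 l2 l3)"
  then have fin: "finite (fin_dim_indec_modules A // module_iso_rel A)"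
    by (simp add: finite_representation_type_def A_def)
  have mem: "cycle_module t \<in> fin_dim_indec_modules A" for t
    unfolding A_def by (rule cycle_module_fin_dim_indec)
  \<comment> \<open>Finitely many classes would make the field finite, which characteristic zero
    excludes.\<close>
  have "inj (\<lambda>t. module_iso_rel A `` {cycle_module t})"
  proof (rule injI)
    fix s t :: 'k
    assume "module_iso_rel A `` {cycle_module s} = module_iso_rel A `` {cycle_module t}"
    then have "(cycle_module s, cycle_module t) \<in> module_iso_rel A"
      using eq_equiv_class module_iso_rel_equiv mem by metis
    then show "s = t"
      by (auto simp: module_iso_rel_def A_def dest: cycle_module_iso_imp_eq)
  qed
  moreover have "range (\<lambda>t. module_iso_rel A `` {cycle_module t})
      \<subseteq> fin_dim_indec_modules A // module_iso_rel A"
    using mem by (auto intro: quotientI)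
  ultimately have "finite (UNIV :: 'k set)"
    using fin finite_imageD finite_subset by metis
  then show False by (simp add: infinite_UNIV_char_0)
qed

end
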